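(* Let $F(\bm{\lambda})=\sum_{i\in[I]}a_i\prod_{j\in[p]}\lambda_j^{n_{i,j}}$ with $a_i\in\mathbb{R}$ and nonnegative integers $n_{i,j}$, let $\bm{l},\bm{u}\in\mathbb{R}^p$ with $l_j<u_j$ for all $j$, and let $\tilde{a}_i$ ($i\in[I]$), $\tilde{b}$ be reals such that $F(\mathrm{diag}(\bm{u}-\bm{l})\bm{\theta}+\bm{l})=\sum_{i\in[I]}\tilde{a}_i\prod_{j\in[p]}\theta_j^{n_{i,j}}+\tilde{b}$ for all $\bm{\theta}$. Let $K>\max\{F(\bm{\lambda}):\bm{l}\le\bm{\lambda}\le\bm{u}\}$ and $f(\bm{\theta})=-\ln\big(K-F(\mathrm{diag}(\bm{u}-\bm{l})\bm{\theta}+\bm{l})\big)$. Let $m_j$ ($j\in[p]$) be positive integers with $m_j\ge\max\{n_{i,j}: i\in[I]\}$, and let $\bm{X}=(X_1,\ldots,X_p)$ be independent binomial random variables $X_j\sim\mathrm{Bin}(m_j,\theta_j)$. If $G$ is defined by $$G(\bm{x})=K-\Big(\sum_{i\in[I]}\tilde{a}_i\prod_{j\in[p]}g_{i,j}(x_j)+\tilde{b}\Big),$$ where $$g_{i,j}(x_j):=\begin{cases}\dfrac{x_j(x_j-1)\cdots(x_j-n_{i,j}+1)}{m_j(m_j-1)\cdots(m_j-n_{i,j}+1)},&n_{i,j}>0,\\ 1,&n_{i,j}=0,\end{cases}$$ then $$f(\bm{\theta})=-\ln\mathbb{E}_{p_{\bm{x}}(\bm{\theta})}[G(\bm{X})]\qquad\text{for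 all }\bm{\theta}\in\mathrm{int}\,[\bm{0},\bm{1}]=(0,1)^p.$$
   Context: $[n]:=\{1,\ldots,n\}$; $\mathrm{diag}(\bm{v})$ is the diagonal matrix with diagonal $\bm{v}$; vector inequalities and intervals are componentwise. $p_{\bm{x}}(\bm{\theta})=\prod_{j\in[p]}\frac{m_j!}{x_j!(m_j-x_j)!}\theta_j^{x_j}(1-\theta_j)^{m_j-x_j}$ for $\bm{x}\in\prod_{j\in[p]}\{0,1,\ldots,m_j\}$ is the joint probability mass function of $\bm{X}$ and $\mathbb{E}_{p_{\bm{x}}(\bm{\theta})}$ the corresponding expectation. *)

theory Defs
  imports "HOL-Probability.Probability"
begin

text \<open>
  The finite index sets $[I]$ and $[p]$ are the finite types \<open>'i\<close> and \<open>'p\<close>; the exponent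
  $n_{i,j}$ is \<open>n $ i $ j\<close>.
\<close>

definition diag :: "real ^ 'p \<Rightarrow> real ^ 'p ^ 'p" where
  "diag v = (\<chi> i j. if i = j then v $ i else 0)"

definition poly_fun :: "real ^ 'i \<Rightarrow> nat ^ 'p ^ 'i \<Rightarrow> real ^ 'p \<Rightarrow> real" where
  "poly_fun a n x = (\<Sum>i\<in>UNIV. a $ i * (\<Prod>j\<in>UNIV. (x $ j) ^ (n $ i $ j)))"

definition log_barrier ::
  "real ^ 'i \<Rightarrow> nat ^ 'p ^ 'i \<Rightarrow> real ^ 'p \<Rightarrow> real ^ 'p \<Rightarrow> real \<Rightarrow> real ^ 'p \<Rightarrow> real" where
  "log_barrier a n l u K \<theta> = - ln (K - poly_fun a n (diag (u - l) *v \<theta> + l))"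

text \<open>
  The subtractions \<open>x - k\<close> and \<open>m - k\<close> below are real ones, so the numerator vanishes for
  \<open>x < d\<close>.
\<close>

definition g_ratio :: "nat \<Rightarrow> nat \<Rightarrow> nat \<Rightarrow> real" where
  "g_ratio m d x =
     (if d > 0 then (\<Prod>k<d. real x - real k) / (\<Prod>k<d. real m - real k) else 1)"

definition G_fun ::
  "real ^ 'i \<Rightarrow> real \<Rightarrow> nat ^ 'p ^ 'i \<Rightarrow> nat ^ 'p \<Rightarrow> real \<Rightarrow> nat ^ 'p \<Rightarrow> real" where
  "G_fun a' b' n m K x =
     K - ((\<Sum>i\<in>UNIV. a' $ i * (\<Prod>j\<in>UNIV. g_ratio (m $ j) (n $ i $ j) (x $ j))) + b')"

text \<open>
  \<open>X j\<close> are independent with \<open>X j\<close> distributed as $\mathrm{Bin}(m_j,\theta_j)$. The library's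
  \<open>binomial_pmf\<close> is meaningful only for a parameter in $[0,1]$.
\<close>

definition (in prob_space) indep_binomials ::
  "nat ^ 'p \<Rightarrow> real ^ 'p \<Rightarrow> ('p \<Rightarrow> 'a \<Rightarrow> nat) \<Rightarrow> bool" where
  "indep_binomials m \<theta> X \<longleftrightarrow>
     indep_vars (\<lambda>_. count_space UNIV) X UNIV \<and>
     (\<forall>j. distr M (count_space UNIV) (X j) = measure_pmf (binomial_pmf (m $ j) (\<theta> $ j)))"

definition joint_pmf :: "nat ^ 'p \<Rightarrow> real ^ 'p \<Rightarrow> nat ^ 'p \<Rightarrow> real" where
  "joint_pmf m \<theta> x =
     (\<Prod>j\<in>UNIV. fact (m $ j) / (fact (x $ j) * fact (m $ j - x $ j))
                 * (\<theta> $ j) ^ (x $ j) * (1 - \<theta> $ j) ^ (m $ j - x $ j))"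

text \<open>
  Hence the expectation of a function of $X$ over the underlying probability space is the
  expectation with respect to the joint probability mass function \<open>joint_pmf m \<theta>\<close>.
\<close>

lemma (in prob_space) indep_binomials_joint_pmf:
  fixes m :: "nat ^ 'p" and \<theta> :: "real ^ 'p"
  assumes X: "indep_binomials m \<theta> X"
    and \<theta>: "\<And>j. 0 \<le> \<theta> $ j \<and> \<theta> $ j \<le> 1"
    and x: "\<And>j. x $ j \<le> m $ j"
  shows "prob {\<omega> \<in> space M. (\<chi> j. X j \<omega>) = x} = joint_pmf m \<theta> x"
proof -
  have ind: "indep_vars (\<lambda>_. count_space UNIV) X UNIV"
    and dis: "\<And>j. distr M (count_space UNIV) (X j) = measure_pmf (binomial_pmf (m $ j) (\<theta> $ j))"
    using X by (auto simp: indep_binomials_def)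
  have meas: "X j \<in> measurable M (count_space UNIV)" for j
    using ind by (auto simp: indep_vars_def)
  have "{\<omega> \<in> space M. (\<chi> j. X j \<omega>) = x} = (\<Inter>j\<in>UNIV. X j -` {x $ j} \<inter> space M)"
    by (auto simp: vec_eq_iff)
  also have "prob \<dots> = (\<Prod>j\<in>UNIV. prob (X j -` {x $ j} \<inter> space M))"
    by (rule indep_varsD[OF ind]) auto
  also have "\<dots> = (\<Prod>j\<in>UNIV. measure (distr M (count_space UNIV) (X j)) {x $ j})"
    by (intro prod.cong refl measure_distr[symmetric] meas) auto
  also have "\<dots> = (\<Prod>j\<in>UNIV. pmf (binomial_pmf (m $ j) (\<theta> $ j)) (x $ j))"
    by (simp add: dis measure_pmf_single)
  also have "\<dots> = joint_pmf m \<theta> x"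
    unfolding joint_pmf_def using \<theta> x
    by (intro prod.cong refl) (simp add: binomial_fact)
  finally show ?thesis .
qed

end

theory Submission
  imports Defs
begin

text \<open>
  The falling factorial moments of \<open>Y \<sim> Bin(m, q)\<close> are
  \<open>E[Y(Y - 1)\<cdots>(Y - d + 1)] = m(m - 1)\<cdots>(m - d + 1) q\<^sup>d\<close>, so for \<open>d \<le> m\<close> the ratio
  \<open>g_ratio m d\<close> is an unbiased estimator of \<open>q\<^sup>d\<close>. Independence turns the expectation of a product
  of such ratios into the monomial in \<open>\<theta>\<close>, and linearity gives the polynomial inside the logarithm.
\<close>

text \<open>Induction on \<open>d\<close> with \<open>m\<close> free: the absorption identity trades
  the leading factor of the falling factorial for a factor depending only on \<open>m\<close>,
  lowering \<open>m\<close> and \<open>d\<close> together. The identity is purely algebraic, hence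
  the general commutative ring.\<close>

lemma binomial_factorial_moment_sum:
  fixes q :: "'a :: comm_ring_1"
  shows "(\<Sum>x\<le>m. of_nat (m choose x) * q ^ x * (1 - q) ^ (m - x) * (\<Prod>k<d. of_nat x - of_nat k))
           = (\<Prod>k<d. of_nat m - of_nat k) * q ^ d"
proof (induction d arbitrary: m)
  case 0
  show ?case
    using binomial_ring[of q "1 - q" m] by simp
next
  case (Suc d)
  show ?case
  proof (cases m)
    case 0
    \<comment> \<open>Both sides vanish: each falling factorial has the factor \<open>0 - 0\<close>
      at \<open>k = 0\<close>.\<close>
    then show ?thesis
      by (simp add: prod.lessThan_Suc_shift del: prod.lessThan_Suc)
  next
    case (Suc m')
    have absorb: "of_nat (Suc m' choose Suc x) * (1 + of_nat x) = (1 + of_nat m') * (of_nat (m' choose x) :: 'a)" for x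
      using arg_cong[OF Suc_times_binomial[of x m'], of "of_nat :: nat \<Rightarrow> 'a"]
      by (simp add: algebra_simps del: binomial_Suc_Suc)
    \<comment> \<open>The term \<open>x = 0\<close> drops out because its factor at
      \<open>k = 0\<close> is zero. After the shift to \<open>Suc x\<close>, that factor is
      \<open>1 + x\<close>, and the remaining ones form the falling factorial of \<open>x\<close> of
      length \<open>d\<close>.\<close>
    have "(\<Sum>x\<le>Suc m'. of_nat (Suc m' choose x) * q ^ x * (1 - q) ^ (Suc m' - x)
              * (\<Prod>k<Suc d. of_nat x - of_nat k))
        = (\<Sum>x\<le>m'. (of_nat (Suc m' choose Suc x) * (1 + of_nat x)) * q ^ Suc x * (1 - q) ^ (m' - x)
              * (\<Prod>k<d. of_nat x - of_nat k))"
      by (simp add: sum.atMost_Suc_shift prod.lessThan_Suc_shift mult_ac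
               del: prod.lessThan_Suc binomial_Suc_Suc sum.atMost_Suc)
    also have "\<dots> = (1 + of_nat m') * q * (\<Sum>x\<le>m'. of_nat (m' choose x) * q ^ x * (1 - q) ^ (m' - x)
              * (\<Prod>k<d. of_nat x - of_nat k))"
      unfolding absorb by (simp add: sum_distrib_left mult_ac)
    also have "\<dots> = (\<Prod>k<Suc d. of_nat (Suc m') - of_nat k) * q ^ Suc d"
      unfolding Suc.IH by (simp add: prod.lessThan_Suc_shift mult_ac del: prod.lessThan_Suc)
    finally show ?thesis
      unfolding Suc .
  qed
qed

lemma expectation_binomial_g_ratio:
  assumes "q \<in> {0..1}" "d \<le> m"
  shows "measure_pmf.expectation (binomial_pmf m q) (g_ratio m d) = q ^ d"
proof -
  \<comment> \<open>Every \<open>k < d\<close> lies strictly below \<open>m\<close>, so no factor is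
    zero.\<close>
  have nz: "(\<Prod>k<d. real m - real k) \<noteq> 0"
    using assms(2) by auto
  \<comment> \<open>For \<open>d = 0\<close> both products are empty, so the quotient is 1 and the
    case split disappears.\<close>
  have g: "g_ratio m d x = (\<Prod>k<d. real x - real k) / (\<Prod>k<d. real m - real k)" for x
    by (simp add: g_ratio_def)
  have "measure_pmf.expectation (binomial_pmf m q) (g_ratio m d)
      = (\<Sum>x\<le>m. real (m choose x) * q ^ x * (1 - q) ^ (m - x) * g_ratio m d x)"
    using assms(1) by (subst expectation_binomial_pmf') (auto simp: mult_ac)
  also have "\<dots> = (\<Prod>k<d. real m - real k) * q ^ d / (\<Prod>k<d. real m - real k)"
    unfolding g times_divide_eq_right
    by (simp only: sum_divide_distrib[symmetric] binomial_factorial_moment_sum)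
  finally show ?thesis
    using nz by simp
qed

context prob_space
begin

lemma indep_binomials_integral:
  fixes g :: "nat \<Rightarrow> real"
  assumes "indep_binomials m \<theta> X"
  shows "integrable M (\<lambda>\<omega>. g (X j \<omega>)) \<longleftrightarrow> integrable (binomial_pmf (m $ j) (\<theta> $ j)) g"
    and "expectation (\<lambda>\<omega>. g (X j \<omega>)) = measure_pmf.expectation (binomial_pmf (m $ j) (\<theta> $ j)) g"
proof -
  have meas: "X j \<in> measurable M (count_space UNIV)"
    and dis: "distr M (count_space UNIV) (X j) = measure_pmf (binomial_pmf (m $ j) (\<theta> $ j))"
    using assms by (auto simp: indep_binomials_def indep_vars_def)
  show "integrable M (\<lambda>\<omega>. g (X j \<omega>)) \<longleftrightarrow> integrable (binomial_pmf (m $ j) (\<theta> $ j)) g"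
    unfolding dis[symmetric] by (rule integrable_distr_eq[symmetric, OF meas]) simp
  show "expectation (\<lambda>\<omega>. g (X j \<omega>)) = measure_pmf.expectation (binomial_pmf (m $ j) (\<theta> $ j)) g"
    unfolding dis[symmetric] by (rule integral_distr[symmetric, OF meas]) simp
qed

text \<open>Applying a function to each \<open>X j\<close> preserves independence, so the
  expectation factorises. Integrability holds for arbitrary \<open>g j\<close> because a binomial
  distribution has finite support.\<close>

lemma indep_binomials_prod:
  fixes g :: "'p::finite \<Rightarrow> nat \<Rightarrow> real" and m :: "nat ^ 'p" and \<theta> :: "real ^ 'p"
  assumes X: "indep_binomials m \<theta> X" and \<theta>: "\<And>j. \<theta> $ j \<in> {0..1}"
  shows "integrable M (\<lambda>\<omega>. \<Prod>j\<in>UNIV. g j (X j \<omega>))"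
    and "expectation (\<lambda>\<omega>. \<Prod>j\<in>UNIV. g j (X j \<omega>))
           = (\<Prod>j\<in>UNIV. measure_pmf.expectation (binomial_pmf (m $ j) (\<theta> $ j)) (g j))"
proof -
  have ind: "indep_vars (\<lambda>_. borel) (\<lambda>j \<omega>. g j (X j \<omega>)) UNIV"
    by (rule indep_vars_compose2[where M' = "\<lambda>_. count_space UNIV" and X = X and Y = g])
      (use X in \<open>simp_all add: indep_binomials_def\<close>)
  have int: "integrable M (\<lambda>\<omega>. g j (X j \<omega>))" for j
    unfolding indep_binomials_integral(1)[OF X]
    by (rule integrable_binomial_pmf[OF \<theta>])
  show "integrable M (\<lambda>\<omega>. \<Prod>j\<in>UNIV. g j (X j \<omega>))"
    by (rule indep_vars_integrable[OF _ ind int]) simp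
  show "expectation (\<lambda>\<omega>. \<Prod>j\<in>UNIV. g j (X j \<omega>))
           = (\<Prod>j\<in>UNIV. measure_pmf.expectation (binomial_pmf (m $ j) (\<theta> $ j)) (g j))"
    using indep_vars_lebesgue_integral[OF _ ind int]
    by (simp add: indep_binomials_integral(2)[OF X])
qed

lemma expectation_G_fun:
  fixes n :: "nat ^ 'p ^ 'i" and m :: "nat ^ 'p::finite" and \<theta> :: "real ^ 'p"
  assumes X: "indep_binomials m \<theta> X" and \<theta>: "\<And>j. \<theta> $ j \<in> {0..1}"
    and n: "\<And>i j. n $ i $ j \<le> m $ j"
  shows "expectation (\<lambda>\<omega>. G_fun a b n m K (\<chi> j. X j \<omega>)) = K - (poly_fun a n \<theta> + b)"
proof -
  \<comment> \<open>Integrability of each monomial's estimator is what allows the expectation to be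
    taken inside the sum over \<open>i\<close>.\<close>
  have int: "integrable M (\<lambda>\<omega>. \<Prod>j\<in>UNIV. g_ratio (m $ j) (n $ i $ j) (X j \<omega>))" for i
    by (rule indep_binomials_prod(1)[OF X \<theta>])
  have "expectation (\<lambda>\<omega>. \<Prod>j\<in>UNIV. g_ratio (m $ j) (n $ i $ j) (X j \<omega>))
      = (\<Prod>j\<in>UNIV. (\<theta> $ j) ^ (n $ i $ j))" for i
    unfolding indep_binomials_prod(2)[OF X \<theta>, where g = "\<lambda>j. g_ratio (m $ j) (n $ i $ j)"]
    by (intro prod.cong refl expectation_binomial_g_ratio \<theta> n)
  then show ?thesis
    by (simp add: G_fun_def poly_fun_def int prob_space)
qed

end

theorem proposition4p4:
  fixes a a' :: "real ^ 'i" and b' K :: real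
    and n :: "nat ^ 'p ^ 'i" and m :: "nat ^ 'p"
    and l u \<theta> :: "real ^ 'p"
    and M :: "'w measure" and X :: "'p \<Rightarrow> 'w \<Rightarrow> nat"
  assumes "\<And>j. l $ j < u $ j"
    and "\<And>t :: real ^ 'p. poly_fun a n (diag (u - l) *v t + l) = poly_fun a' n t + b'"
    and "K > (SUP x\<in>{l..u}. poly_fun a n x)"
    and "\<And>j. m $ j > 0"
    and "\<And>j. m $ j \<ge> Max {n $ i $ j | i. i \<in> UNIV}"
    and "\<theta> \<in> interior {0..1}"
    and "prob_space M"
    and "prob_space.indep_binomials M m \<theta> X"
  shows "log_barrier a n l u K \<theta>
           = - ln (prob_space.expectation M (\<lambda>\<omega>. G_fun a' b' n m K (\<chi> j. X j \<omega>)))"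
proof -
  interpret prob_space M by fact
  have \<theta>: "\<theta> $ j \<in> {0..1}" for j
    using assms(6) interior_subset[of "{0..1 :: real ^ 'p}"] by (auto simp: less_eq_vec_def)
  have n: "n $ i $ j \<le> m $ j" for i j
  proof -
    \<comment> \<open>As the range of a function on a finite type, the set is visibly finite and
      nonempty, so a bound on its \<open>Max\<close> bounds each member.\<close>
    have "{n $ i $ j | i. i \<in> UNIV} = range (\<lambda>i. n $ i $ j)"
      by auto
    with assms(5)[of j] show ?thesis
      by simp
  qed
  show ?thesis
    \<comment> \<open>The assumed expansion, taken at \<open>t = \<theta>\<close>, identifies the
      expectation with the argument of the logarithm in \<open>log_barrier\<close>.\<close>
    using expectation_G_fun[OF assms(8) \<theta> n] assms(2) by (simp add: log_barrier_def)
qed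

end
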